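(* Let $\mathfrak p_1,\mathfrak p_2\in L_{n,m}$ have height sequences $(h^{(1)}_1,\dots,h^{(1)}_n)$ and $(h^{(2)}_1,\dots,h^{(2)}_n)$. Then the relative pseudocomplement $\mathfrak p_1\to\mathfrak p_2$ in $\mathcal{L}_{n,m}$ is the path $\mathfrak p\in L_{n,m}$ with height sequence $(h_1,\dots,h_n)$ defined (recursively from the right) by $$h_i=\begin{cases} m,& i=n \text{ and } h^{(1)}_i\le h^{(2)}_i,\\ h_{i+1},& i<n \text{ and } h^{(1)}_i\le h^{(2)}_i,\\ h^{(2)}_i,& i\le n\text{ and } h^{(1)}_i>h^{(2)}_i.\end{cases}$$
   Context: $L_{n,m}$ is the set of lattice paths from $(0,0)$ to $(n,m)$ using up-steps $(0,1)$ and right-steps $(1,0)$. Such a path is uniquely determined by its height sequence $(h_1,\dots,h_n)$, where $h_i$ is the number of up-steps before the $i$-th right-step; these are exactly the integer sequences $0\le h_1\le h_2\le\dots\le h_n\le m$. $\mathcal{L}_{n,m}$ is $L_{n,m}$ with the dominance order: $\mathfrak p\le_D\mathfrak p'$ iff the height sequences satisfy $h_i\le h'_i$ for all $i$; it is a lattice with meet and join given by componentwise min and max. The relative pseudocomplement $x\to y$ is the greatest $z$ with $x\wedge z\le y$. *)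

theory Defs
  imports "HOL-Algebra.Lattice"
begin

datatype step = Up_Step | Right_Step

text \<open>A path starting at \<open>(0,0)\<close> is encoded by its list of steps, so its end point is
  (number of right-steps, number of up-steps).\<close>

definition lattice_paths :: "nat \<Rightarrow> nat \<Rightarrow> step list set" where
  "lattice_paths n m = {p. count_list p Right_Step = n \<and> count_list p Up_Step = m}"

definition height_seq :: "step list \<Rightarrow> nat list" where
  "height_seq p = [count_list (take j p) Up_Step. j \<leftarrow> [0..<length p], p ! j = Right_Step]"

text \<open>Heights are indexed from 1; \<open>height p i\<close> is meaningful for \<open>1 \<le> i \<le> n\<close> when
  \<open>p \<in> lattice_paths n m\<close>.\<close>

definition height :: "step list \<Rightarrow> nat \<Rightarrow> nat" where
  "height p i = height_seq p ! (i - 1)"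

definition dominance_order :: "nat \<Rightarrow> nat \<Rightarrow> step list gorder" where
  "dominance_order n m =
     \<lparr>carrier = lattice_paths n m, eq = (=),
      le = (\<lambda>p q. \<forall>i\<in>{1..n}. height p i \<le> height q i)\<rparr>"

definition is_relative_pseudocomplement ::
    "('a, 'b) gorder_scheme \<Rightarrow> 'a \<Rightarrow> 'a \<Rightarrow> 'a \<Rightarrow> bool" where
  "is_relative_pseudocomplement L x y z \<longleftrightarrow>
     greatest L z {w \<in> carrier L. x \<sqinter>\<^bsub>L\<^esub> w \<sqsubseteq>\<^bsub>L\<^esub> y}"

end

theory Submission
  imports Defs
begin

text \<open>Paths in \<open>L\<^sub>n\<^sub>,\<^sub>m\<close> correspond bijectively to weakly increasing height functions bounded
  by \<open>m\<close>, and the dominance order is the pointwise order. For such a function \<open>h\<close>, the condition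
  \<open>min f h \<le> g\<close> only says that \<open>h j \<le> g j\<close> at every index \<open>j\<close> with \<open>g j < f j\<close>; by monotonicity of
  \<open>h\<close> this is the same as \<open>h i \<le> min {m, g j | j \<ge> i, g j < f j}\<close> for all \<open>i\<close>. The right-hand side
  is itself a height function, hence the relative pseudocomplement of \<open>f\<close> and \<open>g\<close>. Since \<open>g\<close> is
  increasing, it satisfies the stated recursion, which determines it by descending induction.\<close>

subsection \<open>Relative pseudocomplements of bounded monotone functions\<close>

definition bounded_mono_on :: "'i::order set \<Rightarrow> 'a::order \<Rightarrow> ('i \<Rightarrow> 'a) set" where
  "bounded_mono_on I m = {f. mono_on I f \<and> (\<forall>i\<in>I. f i \<le> m)}"

lemma min_bounded_mono_on:
  fixes m :: "'a::linorder"
  assumes "f \<in> bounded_mono_on I m" "g \<in> bounded_mono_on I m"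
  shows "(\<lambda>i. min (f i) (g i)) \<in> bounded_mono_on I m"
  using assms by (auto simp: bounded_mono_on_def mono_on_def min_le_iff_disj)

lemma bounded_mono_on_iff_sorted_map:
  "f \<in> bounded_mono_on {a..n} m \<longleftrightarrow>
     sorted (map f [a..<n + 1]) \<and> set (map f [a..<n + 1]) \<subseteq> {..m}"
proof -
  have "sorted (map f [a..<n + 1]) \<longleftrightarrow> (\<forall>i j. i \<le> j \<and> a + j \<le> n \<longrightarrow> f (a + i) \<le> f (a + j))"
    by (auto simp: sorted_iff_nth_mono simp del: upt_Suc)
  also have "\<dots> \<longleftrightarrow> mono_on {a..n} f"
    unfolding mono_on_def by (auto simp: le_iff_add)
  finally show ?thesis
    by (simp add: bounded_mono_on_def image_subset_iff atLeastLessThanSuc_atLeastAtMost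
        del: upt_Suc)
qed

definition rel_pseudocomplement ::
    "'i::order set \<Rightarrow> 'a::linorder \<Rightarrow> ('i \<Rightarrow> 'a) \<Rightarrow> ('i \<Rightarrow> 'a) \<Rightarrow> 'i \<Rightarrow> 'a" where
  "rel_pseudocomplement I m f g i = Min (insert m (g ` {j \<in> I. i \<le> j \<and> g j < f j}))"

lemma le_rel_pseudocomplement_iff:
  assumes "finite I"
  shows "x \<le> rel_pseudocomplement I m f g i \<longleftrightarrow>
    x \<le> m \<and> (\<forall>j\<in>I. i \<le> j \<and> g j < f j \<longrightarrow> x \<le> g j)"
  using assms by (auto simp: rel_pseudocomplement_def)

lemma rel_pseudocomplement_bounded_mono_on:
  assumes "finite I"
  shows "rel_pseudocomplement I m f g \<in> bounded_mono_on I m"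
proof -
  let ?c = "rel_pseudocomplement I m f g"
  have bounds: "?c i \<le> m \<and> (\<forall>j\<in>I. i \<le> j \<and> g j < f j \<longrightarrow> ?c i \<le> g j)" for i
    using le_rel_pseudocomplement_iff[OF assms] by blast
  have "mono_on I ?c"
    by (rule mono_onI, subst le_rel_pseudocomplement_iff[OF assms])
       (use bounds in \<open>auto dest: order_trans\<close>)
  with bounds show ?thesis
    by (simp add: bounded_mono_on_def)
qed

lemma min_le_iff_le_rel_pseudocomplement:
  assumes "finite I" and h: "h \<in> bounded_mono_on I m"
  shows "(\<forall>i\<in>I. min (f i) (h i) \<le> g i) \<longleftrightarrow> (\<forall>i\<in>I. h i \<le> rel_pseudocomplement I m f g i)"
proof -
  have mono: "h i \<le> h j" if "i \<in> I" "j \<in> I" "i \<le> j" for i j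
    using h that by (auto simp: bounded_mono_on_def dest: mono_onD)
  have "(\<forall>i\<in>I. min (f i) (h i) \<le> g i) \<longleftrightarrow> (\<forall>j\<in>I. g j < f j \<longrightarrow> h j \<le> g j)"
    by (auto simp: min_le_iff_disj not_le)
  also have "\<dots> \<longleftrightarrow> (\<forall>i\<in>I. \<forall>j\<in>I. i \<le> j \<and> g j < f j \<longrightarrow> h i \<le> g j)"
    using mono by (meson order_refl order_trans)
  also have "\<dots> \<longleftrightarrow> (\<forall>i\<in>I. h i \<le> rel_pseudocomplement I m f g i)"
    using h by (auto simp: bounded_mono_on_def le_rel_pseudocomplement_iff[OF assms(1)])
  finally show ?thesis .
qed

lemma rel_pseudocomplement_rec:
  fixes a n :: nat
  assumes g: "g \<in> bounded_mono_on {a..n} m" and i: "i \<in> {a..n}"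
  shows "rel_pseudocomplement {a..n} m f g i =
    (if f i > g i then g i else if i = n then m else rel_pseudocomplement {a..n} m f g (i + 1))"
proof (cases "f i > g i")
  case True
  have "rel_pseudocomplement {a..n} m f g i = g i"
    unfolding rel_pseudocomplement_def
    by (rule Min_eqI) (use g i True in \<open>auto simp: bounded_mono_on_def mono_on_def\<close>)
  with True show ?thesis by simp
next
  case False
  then have later: "{j \<in> {a..n}. i \<le> j \<and> g j < f j} = {j \<in> {a..n}. i + 1 \<le> j \<and> g j < f j}"
    by (auto simp: Suc_le_eq le_less)
  have "rel_pseudocomplement {a..n} m f g i = rel_pseudocomplement {a..n} m f g (i + 1)"
    unfolding rel_pseudocomplement_def later ..
  moreover have "rel_pseudocomplement {a..n} m f g (n + 1) = m"
    by (auto simp: rel_pseudocomplement_def intro!: Min_eqI)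
  ultimately show ?thesis
    using False by auto
qed

lemma descending_recursion_unique:
  fixes f g :: "nat \<Rightarrow> 'a"
  assumes f: "\<forall>i\<in>{a..n}. f i = F i (if i = n then c else f (i + 1))"
    and g: "\<forall>i\<in>{a..n}. g i = F i (if i = n then c else g (i + 1))"
  shows "\<forall>i\<in>{a..n}. f i = g i"
proof
  fix i assume "i \<in> {a..n}"
  then have "i \<le> n" "a \<le> i" by auto
  then show "f i = g i"
  proof (induction i rule: inc_induct)
    case base
    then show ?case using bspec[OF f, of n] bspec[OF g, of n] by simp
  next
    case (step k)
    then show ?case using bspec[OF f, of k] bspec[OF g, of k] by simp
  qed
qed

lemma recursion_iff_eq_rel_pseudocomplement:
  fixes a n :: nat
  assumes g: "g \<in> bounded_mono_on {a..n} m"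
  shows "(\<forall>i\<in>{a..n}. h i = (if f i > g i then g i else if i = n then m else h (i + 1))) \<longleftrightarrow>
    (\<forall>i\<in>{a..n}. h i = rel_pseudocomplement {a..n} m f g i)"
    (is "?rec h \<longleftrightarrow> (\<forall>i\<in>_. h i = ?c i)")
proof
  assume "?rec h"
  then show "\<forall>i\<in>{a..n}. h i = ?c i"
    by (rule descending_recursion_unique[where F = "\<lambda>i x. if f i > g i then g i else x"])
       (intro ballI rel_pseudocomplement_rec[OF g])
next
  assume eq: "\<forall>i\<in>{a..n}. h i = ?c i"
  show "?rec h"
  proof
    fix i assume i: "i \<in> {a..n}"
    with rel_pseudocomplement_rec[OF g i, of f] eq
    show "h i = (if f i > g i then g i else if i = n then m else h (i + 1))"
      by simp
  qed
qed

subsection \<open>Height sequences\<close>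

lemma height_seq_Nil [simp]: "height_seq [] = []"
  by (simp add: height_seq_def)

lemma height_seq_Cons [simp]:
  "height_seq (s # p) =
     (case s of Up_Step \<Rightarrow> map Suc (height_seq p) | Right_Step \<Rightarrow> 0 # height_seq p)"
proof -
  have split: "[0..<length (s # p)] = 0 # map Suc [0..<length p]"
    by (simp add: upt_conv_Cons map_Suc_upt del: upt_Suc)
  show ?thesis
    unfolding height_seq_def split
    by (cases s) (simp_all add: map_concat o_def if_distrib cong: if_cong)
qed

lemma height_seq_append:
  "height_seq (p @ q) = height_seq p @ map ((+) (count_list p Up_Step)) (height_seq q)"
  by (induction p) (auto split: step.split)

lemma height_seq_replicate_Up [simp]: "height_seq (replicate k Up_Step) = []"
  by (induction k) auto

lemma length_height_seq: "length (height_seq p) = count_list p Right_Step"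
  by (induction p) (auto split: step.split)

lemma sorted_height_seq: "sorted (height_seq p)"
  by (induction p) (auto simp: sorted_map split: step.split)

lemma set_height_seq_subset: "set (height_seq p) \<subseteq> {..count_list p Up_Step}"
  by (induction p) (auto split: step.split)

lemma height_seq_inject:
  "height_seq p = height_seq q \<Longrightarrow> count_list p Up_Step = count_list q Up_Step \<Longrightarrow> p = q"
  by (induction p q rule: list_induct2')
     (auto simp: Cons_eq_map_conv map_eq_Cons_conv split: step.splits)

lemma count_list_replicate: "count_list (replicate k x) y = (if x = y then k else 0)"
  by (induction k) auto

lemma ex_lattice_path_height_seq:
  assumes "sorted hs" "set hs \<subseteq> {..m}"
  shows "\<exists>p\<in>lattice_paths (length hs) m. height_seq p = hs"
  using assms
proof (induction hs arbitrary: m rule: rev_induct)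
  case Nil
  show ?case
    by (rule bexI[of _ "replicate m Up_Step"])
       (simp_all add: lattice_paths_def count_list_replicate)
next
  case (snoc h hs)
  then have "sorted hs" "set hs \<subseteq> {..h}" "h \<le> m"
    by (auto simp: sorted_append)
  with snoc.IH obtain p where p: "p \<in> lattice_paths (length hs) h" "height_seq p = hs"
    by blast
  let ?q = "p @ Right_Step # replicate (m - h) Up_Step"
  have "?q \<in> lattice_paths (length (hs @ [h])) m" "height_seq ?q = hs @ [h]"
    using p \<open>h \<le> m\<close>
    by (simp_all add: lattice_paths_def height_seq_append count_list_replicate)
  then show ?case by blast
qed

lemma bij_betw_height_seq:
  "bij_betw height_seq (lattice_paths n m) {hs. sorted hs \<and> length hs = n \<and> set hs \<subseteq> {..m}}"
    (is "bij_betw _ ?A ?B")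
  unfolding bij_betw_def
proof
  show "inj_on height_seq ?A"
    by (auto intro!: inj_onI height_seq_inject simp: lattice_paths_def)
  have "height_seq ` ?A \<subseteq> ?B"
    using sorted_height_seq length_height_seq set_height_seq_subset
    by (fastforce simp: lattice_paths_def)
  moreover have "?B \<subseteq> height_seq ` ?A"
    using ex_lattice_path_height_seq by blast
  ultimately show "height_seq ` ?A = ?B" ..
qed

lemma height_seq_eq_map_height:
  assumes "p \<in> lattice_paths n m"
  shows "height_seq p = map (height p) [1..<n + 1]"
  using assms
  by (intro nth_equalityI)
     (simp_all add: height_def lattice_paths_def length_height_seq del: upt_Suc)

lemma height_bounded_mono_on:
  assumes "p \<in> lattice_paths n m"
  shows "height p \<in> bounded_mono_on {1..n} m"
  unfolding bounded_mono_on_iff_sorted_map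
  using bij_betw_apply[OF bij_betw_height_seq assms] height_seq_eq_map_height[OF assms] by simp

lemma lattice_path_eqI:
  assumes p: "p \<in> lattice_paths n m" and q: "q \<in> lattice_paths n m"
    and eq: "\<And>i. i \<in> {1..n} \<Longrightarrow> height p i = height q i"
  shows "p = q"
proof (rule inj_onD[OF bij_betw_imp_inj_on[OF bij_betw_height_seq] _ p q])
  show "height_seq p = height_seq q"
    unfolding height_seq_eq_map_height[OF p] height_seq_eq_map_height[OF q]
    by (rule map_cong) (simp_all add: eq del: upt_Suc)
qed

lemma ex_lattice_path_height:
  assumes f: "f \<in> bounded_mono_on {1..n} m"
  obtains p where "p \<in> lattice_paths n m" "\<And>i. i \<in> {1..n} \<Longrightarrow> height p i = f i"
proof -
  have "map f [1..<n + 1] \<in> height_seq ` lattice_paths n m"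
    using f bij_betw_imp_surj_on[OF bij_betw_height_seq]
    by (simp add: bounded_mono_on_iff_sorted_map del: upt_Suc)
  then obtain p where p: "p \<in> lattice_paths n m" and "height_seq p = map f [1..<n + 1]"
    by auto
  then have "map (height p) [1..<n + 1] = map f [1..<n + 1]"
    using height_seq_eq_map_height[OF p] by simp
  then have "height p i = f i" if "i \<in> {1..n}" for i
    using that by (simp add: map_eq_conv del: upt_Suc)
  with p show ?thesis by (rule that)
qed

subsection \<open>The dominance order\<close>

lemma dominance_order_simps [simp]:
  "carrier (dominance_order n m) = lattice_paths n m"
  "(.=\<^bsub>dominance_order n m\<^esub>) = (=)"
  "p \<sqsubseteq>\<^bsub>dominance_order n m\<^esub> q \<longleftrightarrow> (\<forall>i\<in>{1..n}. height p i \<le> height q i)"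
  by (simp_all add: dominance_order_def)

lemma partial_order_dominance_order: "partial_order (dominance_order n m)"
proof
  show "x .=\<^bsub>dominance_order n m\<^esub> y"
    if "x \<sqsubseteq>\<^bsub>dominance_order n m\<^esub> y" "y \<sqsubseteq>\<^bsub>dominance_order n m\<^esub> x"
      "x \<in> carrier (dominance_order n m)" "y \<in> carrier (dominance_order n m)" for x y
    using that by (auto intro!: lattice_path_eqI[of x n m y] antisym)
qed (auto intro: order_trans)

lemma (in partial_order) meet_eqI:
  assumes "greatest L z (Lower L {x, y})"
  shows "x \<sqinter> y = z"
  unfolding meet_def inf_def
  using assms by (blast intro: someI2 greatest_unique)

lemma height_meet:
  assumes p: "p \<in> lattice_paths n m" and q: "q \<in> lattice_paths n m" and i: "i \<in> {1..n}"
  shows "height (p \<sqinter>\<^bsub>dominance_order n m\<^esub> q) i = min (height p i) (height q i)"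
proof -
  let ?L = "dominance_order n m"
  obtain r where r: "r \<in> lattice_paths n m"
      "\<And>i. i \<in> {1..n} \<Longrightarrow> height r i = min (height p i) (height q i)"
    using ex_lattice_path_height[OF min_bounded_mono_on[OF p[THEN height_bounded_mono_on]
        q[THEN height_bounded_mono_on]]] by blast
  have "greatest ?L r (Lower ?L {p, q})"
    using p q r by (auto simp: greatest_def Lower_def)
  then have "p \<sqinter>\<^bsub>?L\<^esub> q = r"
    by (rule partial_order.meet_eqI[OF partial_order_dominance_order])
  with r i show ?thesis by simp
qed

lemma is_relative_pseudocomplement_dominance_order:
  assumes x: "x \<in> lattice_paths n m" and z: "z \<in> lattice_paths n m"
    and height_z: "\<And>i. i \<in> {1..n} \<Longrightarrow>
      height z i = rel_pseudocomplement {1..n} m (height x) (height y) i"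
  shows "is_relative_pseudocomplement (dominance_order n m) x y z"
proof -
  let ?L = "dominance_order n m"
  have "x \<sqinter>\<^bsub>?L\<^esub> w \<sqsubseteq>\<^bsub>?L\<^esub> y \<longleftrightarrow> w \<sqsubseteq>\<^bsub>?L\<^esub> z" if w: "w \<in> lattice_paths n m" for w
    using min_le_iff_le_rel_pseudocomplement[OF _ height_bounded_mono_on[OF w],
        of "height x" "height y"]
    by (simp add: height_meet[OF x w] height_z)
  then show ?thesis
    unfolding is_relative_pseudocomplement_def greatest_def using z by auto
qed

theorem theorem3p1:
  fixes n m :: nat and p1 p2 :: "step list"
  assumes "p1 \<in> lattice_paths n m" and "p2 \<in> lattice_paths n m"
  shows "\<exists>p. (\<forall>q. (q \<in> lattice_paths n m \<and>
                 (\<forall>i\<in>{1..n}. height q i =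
                    (if height p1 i > height p2 i then height p2 i
                     else if i = n then m
                     else height q (i + 1)))) \<longleftrightarrow> q = p) \<and>
             is_relative_pseudocomplement (dominance_order n m) p1 p2 p"
proof -
  let ?h = "rel_pseudocomplement {1..n} m (height p1) (height p2)"
  have "?h \<in> bounded_mono_on {1..n} m"
    by (simp add: rel_pseudocomplement_bounded_mono_on)
  then obtain p where p: "p \<in> lattice_paths n m" "\<And>i. i \<in> {1..n} \<Longrightarrow> height p i = ?h i"
    by (rule ex_lattice_path_height) blast
  have "q \<in> lattice_paths n m \<and> (\<forall>i\<in>{1..n}. height q i =
      (if height p1 i > height p2 i then height p2 i else if i = n then m else height q (i + 1)))
      \<longleftrightarrow> q = p" for q
    unfolding recursion_iff_eq_rel_pseudocomplement[OF height_bounded_mono_on[OF assms(2)]]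
    using p by (auto intro: lattice_path_eqI)
  moreover have "is_relative_pseudocomplement (dominance_order n m) p1 p2 p"
    using assms(1) p by (rule is_relative_pseudocomplement_dominance_order)
  ultimately show ?thesis by blast
qed

end
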